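(* Let $A\in\mathcal A$ with $\mu(A)>0$, let $r>0$ and let $g,h\in L_p(S;X)$ with $h\neq\theta$. In each of the following cases the directional derivative $P'_{B_A(r)}(g)(h)$ of the metric projection $P_{B_A(r)}:L_p(S;X)\to B_A(r)$ exists and is given as stated. (a) If $g\in B_A^o(r)$, then $$P'_{B_A(r)}(g)(h)=\begin{cases}h,&\text{for }h\in L_p(A;X),\\ h_A,&\text{for }h\notin L_p(A;X).\end{cases}$$ (b) If $g\in L_p(A;X)\setminus B_A(r)$, then $$P'_{B_A(r)}(g)(h)=\begin{cases}\dfrac{r}{\|g\|_{L_p(A;X)}}\left(h-\dfrac{\Psi_p(g,h)}{\|g\|_{L_p(A;X)}}g\right),&\text{for }h\in L_p(A;X),\\[2mm] \dfrac{r}{\|g\|_{L_p(A;X)}}\left(h_A-\dfrac{\Psi_p(g,h_A)}{\|g\|_{L_p(A;X)}}g\right),&\text{for }h\notin L_p(A;X).\end{cases}$$ In particular, $P'_{B_A(r)}(g)(g)=\theta$ for every $g\in L_p(A;X)\setminus B_A(r)$. (c) If $g\in C_A^o(r)\setminus L_p(A;X)$, then $P'_{B_A(r)}(g)(h)=h_A$. (d) If $g\in L_p(S;X)\setminus(C_A(r)\cup L_p(A;X))$, then $$P'_{B_A(r)}(g)(h)=\frac{r}{\|g_A\|_{L_p(A;X)}}\left(h_A-\frac{\Psi_p(g_A,h_A)}{\|g_A\|_{L_p(A;X)}}g_A\right).$$ In particular, $P'_{B_A(r)}(g)(g)=\theta$ for every $g\in L_p(S;X)\setminus(C_A(r)\cup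 L_p(A;X))$.
   Context: Let $(S,\mathcal A,\mu)$ be a positive measure space, $X$ a real uniformly convex and uniformly smooth Banach space, and $1<p<\infty$. $L_p(S;X)$ is the Bochner space of ($\mu$-equivalence classes of) strongly measurable $f:S\to X$ with $\|f\|_{L_p(S;X)}=\left(\int_S\|f(s)\|_X^p\,d\mu(s)\right)^{1/p}<\infty$; it is a uniformly convex and uniformly smooth Banach space. For $A\in\mathcal A$ with $\mu(A)>0$, $L_p(A;X)$ is the subspace $\{f\in L_p(S;X): f(s)=\theta \text{ for } \mu\text{-a.e. } s\in S\setminus A\}$ ($\theta$ denotes the zero vector) with the induced norm, denoted $\|\cdot\|_{L_p(A;X)}$. For $f\in L_p(S;X)$, $f_A$ is defined by $f_A(s)=f(s)$ for $s\in A$ and $f_A(s)=\theta$ for $s\notin A$. For $r>0$: $B_A(r)=\{f\in L_p(A;X):\|f\|_{L_p(A;X)}\le r\}$, $B_A^o(r)=\{f\in L_p(A;X):\|f\|_{L_p(A;X)}<r\}$, $C_A(r)=\{f\in L_p(S;X): f_A\in B_A(r)\}$, $C_A^o(r)=\{f\in L_p(S;X): f_A\in B_A^o(r)\}$. The function of smoothness of $L_p(S;X)$ is $\Psi_p(x,v)=\lim_{t\downarrow0}\frac{\|x+tv\|_{L_p(S;X)}-\|x\|_{L_p(S;X)}}{t}$ (this limit exists for all $x$ and $v$; $\Psi_p(x,\theta)=0$). For a nonempty closed convex subset $C$ of a uniformly convex and uniformly smooth Banach space $Z$, the metric projection $P_C:Z\to C$ assigns to $x$ the unique point $P_Cx\in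 C$ with $\|x-P_Cx\|\le\|x-z\|$ for all $z\in C$, and its directional derivative at $x$ along $v\ne\theta$ is $P_C'(x)(v)=\lim_{t\downarrow0}\frac{P_C(x+tv)-P_C(x)}{t}$ (norm limit), when it exists. *)

theory Defs
  imports "HOL-Analysis.Analysis"
begin

text \<open>Uniform convexity and uniform smoothness of a real normed space, written out from the
  moduli of convexity (positive at every \<open>\<epsilon>\<close>) and of smoothness (\<open>\<rho>(t) / t \<longlongrightarrow> 0\<close> as
  \<open>t \<down> 0\<close>), so that the zero space and one-dimensional spaces need no convention on
  empty infima and suprema.\<close>

definition uniformly_convex :: "'b::real_normed_vector itself \<Rightarrow> bool" where
  "uniformly_convex _ \<longleftrightarrow>
     (\<forall>\<epsilon>>0. \<exists>\<delta>>0. \<forall>x y::'b. norm x = 1 \<and> norm y = 1 \<and> norm (x - y) \<ge> \<epsilon>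
        \<longrightarrow> norm ((1/2) *\<^sub>R (x + y)) \<le> 1 - \<delta>)"

definition uniformly_smooth :: "'b::real_normed_vector itself \<Rightarrow> bool" where
  "uniformly_smooth _ \<longleftrightarrow>
     (\<forall>\<epsilon>>0. \<exists>\<delta>>0. \<forall>t. 0 < t \<and> t \<le> \<delta> \<longrightarrow>
        (\<forall>x y::'b. norm x = 1 \<and> norm y = 1
           \<longrightarrow> (norm (x + t *\<^sub>R y) + norm (x - t *\<^sub>R y)) / 2 - 1 \<le> \<epsilon> * t))"

text \<open>The target need not be separable, so Borel measurability would be too weak. Requiring
  convergence everywhere rather than almost everywhere gives the same equivalence classes and
  makes the function itself Borel measurable even when \<open>M\<close> is not complete.\<close>

definition strongly_measurable :: "'a measure \<Rightarrow> ('a \<Rightarrow> 'b::real_normed_vector) \<Rightarrow> bool" where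
  "strongly_measurable M f \<longleftrightarrow>
     (\<exists>u. (\<forall>n::nat. simple_function M (u n)) \<and> (\<forall>s\<in>space M. (\<lambda>n. u n s) \<longlonglongrightarrow> f s))"

definition Lp_fun :: "'a measure \<Rightarrow> real \<Rightarrow> ('a \<Rightarrow> 'b::real_normed_vector) set" where
  "Lp_fun M p =
     {f. strongly_measurable M f \<and> (\<integral>\<^sup>+ s. ennreal (norm (f s) powr p) \<partial>M) < \<infinity>}"

definition Lp_rel ::
    "'a measure \<Rightarrow> real \<Rightarrow> (('a \<Rightarrow> 'b::real_normed_vector) \<times> ('a \<Rightarrow> 'b)) set" where
  "Lp_rel M p = {(f, g). f \<in> Lp_fun M p \<and> g \<in> Lp_fun M p \<and> (AE s in M. f s = g s)}"

definition Lp_class ::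
    "'a measure \<Rightarrow> real \<Rightarrow> ('a \<Rightarrow> 'b::real_normed_vector) \<Rightarrow> ('a \<Rightarrow> 'b) set" where
  "Lp_class M p f = Lp_rel M p `` {f}"

text \<open>The space \<open>L\<^sub>p(S; X)\<close>, where \<open>S = space M\<close> and \<open>X\<close> is the type \<open>'b\<close>. Its elements are
  equivalence classes; the operations below do not depend on the representatives, so that the
  unions over representatives are single classes.\<close>

definition Lp :: "'a measure \<Rightarrow> real \<Rightarrow> ('a \<Rightarrow> 'b::real_normed_vector) set set" where
  "Lp M p = Lp_fun M p // Lp_rel M p"

definition Lp_zero :: "'a measure \<Rightarrow> real \<Rightarrow> ('a \<Rightarrow> 'b::real_normed_vector) set" where
  "Lp_zero M p = Lp_class M p (\<lambda>_. 0)"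

definition Lp_add ::
    "'a measure \<Rightarrow> real \<Rightarrow> ('a \<Rightarrow> 'b::real_normed_vector) set \<Rightarrow> ('a \<Rightarrow> 'b) set \<Rightarrow> ('a \<Rightarrow> 'b) set"
  where "Lp_add M p F G = (\<Union>f\<in>F. \<Union>g\<in>G. Lp_class M p (\<lambda>s. f s + g s))"

definition Lp_diff ::
    "'a measure \<Rightarrow> real \<Rightarrow> ('a \<Rightarrow> 'b::real_normed_vector) set \<Rightarrow> ('a \<Rightarrow> 'b) set \<Rightarrow> ('a \<Rightarrow> 'b) set"
  where "Lp_diff M p F G = (\<Union>f\<in>F. \<Union>g\<in>G. Lp_class M p (\<lambda>s. f s - g s))"

definition Lp_scale ::
    "'a measure \<Rightarrow> real \<Rightarrow> real \<Rightarrow> ('a \<Rightarrow> 'b::real_normed_vector) set \<Rightarrow> ('a \<Rightarrow> 'b) set"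
  where "Lp_scale M p c F = (\<Union>f\<in>F. Lp_class M p (\<lambda>s. c *\<^sub>R f s))"

definition Lp_restr ::
    "'a measure \<Rightarrow> real \<Rightarrow> 'a set \<Rightarrow> ('a \<Rightarrow> 'b::real_normed_vector) set \<Rightarrow> ('a \<Rightarrow> 'b) set"
  where "Lp_restr M p A F = (\<Union>f\<in>F. Lp_class M p (\<lambda>s. if s \<in> A then f s else 0))"

definition Lp_norm :: "'a measure \<Rightarrow> real \<Rightarrow> ('a \<Rightarrow> 'b::real_normed_vector) set \<Rightarrow> real" where
  "Lp_norm M p F = the_elem ((\<lambda>f. (\<integral>s. norm (f s) powr p \<partial>M) powr (1 / p)) ` F)"

text \<open>\<open>L\<^sub>p(A; X)\<close> as a subspace of \<open>L\<^sub>p(S; X)\<close>; its norm is the induced one, that is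
  \<open>Lp_norm M p\<close>.\<close>

definition Lp_on ::
    "'a measure \<Rightarrow> real \<Rightarrow> 'a set \<Rightarrow> ('a \<Rightarrow> 'b::real_normed_vector) set set" where
  "Lp_on M p A = {F \<in> Lp M p. \<forall>f\<in>F. AE s in M. s \<notin> A \<longrightarrow> f s = 0}"

definition Lp_cball ::
    "'a measure \<Rightarrow> real \<Rightarrow> 'a set \<Rightarrow> real \<Rightarrow> ('a \<Rightarrow> 'b::real_normed_vector) set set" where
  "Lp_cball M p A r = {F \<in> Lp_on M p A. Lp_norm M p F \<le> r}"

definition Lp_ball ::
    "'a measure \<Rightarrow> real \<Rightarrow> 'a set \<Rightarrow> real \<Rightarrow> ('a \<Rightarrow> 'b::real_normed_vector) set set" where
  "Lp_ball M p A r = {F \<in> Lp_on M p A. Lp_norm M p F < r}"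

definition Lp_ccyl ::
    "'a measure \<Rightarrow> real \<Rightarrow> 'a set \<Rightarrow> real \<Rightarrow> ('a \<Rightarrow> 'b::real_normed_vector) set set" where
  "Lp_ccyl M p A r = {F \<in> Lp M p. Lp_restr M p A F \<in> Lp_cball M p A r}"

definition Lp_cyl ::
    "'a measure \<Rightarrow> real \<Rightarrow> 'a set \<Rightarrow> real \<Rightarrow> ('a \<Rightarrow> 'b::real_normed_vector) set set" where
  "Lp_cyl M p A r = {F \<in> Lp M p. Lp_restr M p A F \<in> Lp_ball M p A r}"

text \<open>The function of smoothness \<open>\<Psi>\<^sub>p\<close>.\<close>

definition Lp_smoothness ::
    "'a measure \<Rightarrow> real \<Rightarrow> ('a \<Rightarrow> 'b::real_normed_vector) set \<Rightarrow> ('a \<Rightarrow> 'b) set \<Rightarrow> real" where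
  "Lp_smoothness M p F V =
     Lim (at_right 0)
       (\<lambda>t. (Lp_norm M p (Lp_add M p F (Lp_scale M p t V)) - Lp_norm M p F) / t)"

definition Lp_proj ::
    "'a measure \<Rightarrow> real \<Rightarrow> ('a \<Rightarrow> 'b::real_normed_vector) set set \<Rightarrow>
      ('a \<Rightarrow> 'b) set \<Rightarrow> ('a \<Rightarrow> 'b) set" where
  "Lp_proj M p C F =
     (THE Y. Y \<in> C \<and> (\<forall>Z\<in>C. Lp_norm M p (Lp_diff M p F Y) \<le> Lp_norm M p (Lp_diff M p F Z)))"

text \<open>\<open>Lp_has_dir_deriv M p T G V D\<close>: the one-sided directional derivative of \<open>T\<close> at \<open>G\<close>
  along \<open>V\<close> exists as a limit in the norm of \<open>L\<^sub>p(S; X)\<close>, and equals \<open>D\<close>.\<close>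

definition Lp_has_dir_deriv ::
    "'a measure \<Rightarrow> real \<Rightarrow> (('a \<Rightarrow> 'b::real_normed_vector) set \<Rightarrow> ('a \<Rightarrow> 'b) set) \<Rightarrow>
      ('a \<Rightarrow> 'b) set \<Rightarrow> ('a \<Rightarrow> 'b) set \<Rightarrow> ('a \<Rightarrow> 'b) set \<Rightarrow> bool" where
  "Lp_has_dir_deriv M p T G V D \<longleftrightarrow>
     D \<in> Lp M p \<and>
     ((\<lambda>t. Lp_norm M p
             (Lp_diff M p
               (Lp_scale M p (1 / t) (Lp_diff M p (T (Lp_add M p G (Lp_scale M p t V))) (T G)))
               D))
        \<longlongrightarrow> 0) (at_right 0)"

end

theory Submission
  imports Defs
begin

text \<open>Write \<open>f\<^sub>A\<close> for the function that is \<open>f\<close> on \<open>A\<close> and zero elsewhere. For \<open>z\<close> supported in \<open>A\<close> the \<open>p\<close>-th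
  power of the distance from \<open>f\<close> to \<open>z\<close> is that from \<open>f\<^sub>A\<close> to \<open>z\<close> plus a constant, so the projection of
  \<open>f\<close> onto the ball of \<open>L\<^sub>p(A; X)\<close> is the radial retraction of \<open>f\<^sub>A\<close>; uniqueness comes from the
  strict convexity of \<open>x \<mapsto> \<parallel>x\<parallel>\<^sup>p\<close> on \<open>X\<close>, integrated. Since \<open>n(t) = \<parallel>f\<^sub>A + t h\<^sub>A\<parallel>\<close> is convex in \<open>t\<close>, its right
  derivative \<open>\<Psi>\<^sub>p(f\<^sub>A, h\<^sub>A)\<close> exists at \<open>0\<close>, and the projected curve \<open>c(n(t)) (f\<^sub>A + t h\<^sub>A)\<close>, with \<open>c(n) = 1\<close> for
  \<open>n \<le> r\<close> and \<open>c(n) = r / n\<close> beyond, is differentiated by the product rule.\<close>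

subsection \<open>Strict convexity of powers of the norm\<close>

text \<open>By the mean value theorem the slope of the chord between \<open>x\<close> and
  \<open>y\<close> is the derivative at an intermediate point, and that derivative is strictly
  increasing because \<open>p > 1\<close>. The point \<open>x = 0\<close> is treated separately,
  since the derivative rule for \<open>powr\<close> is applied at positive arguments only.\<close>

lemma powr_tangent_less:
  fixes x y p :: real
  assumes "0 < y" "0 \<le> x" "x \<noteq> y" "1 < p"
  shows "y powr p + p * y powr (p - 1) * (x - y) < x powr p"
proof (cases "x = 0")
  case True
  have "y powr p = y * y powr (p - 1)"
    using assms by (simp add: powr_mult_base)
  \<comment> \<open>At \<open>x = 0\<close> the claim reads
    \<open>y powr p < p * y powr p\<close>.\<close>
  moreover have "1 * (y * y powr (p - 1)) < p * (y * y powr (p - 1))"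
    using assms by (intro mult_strict_right_mono) auto
  ultimately show ?thesis
    using True assms by (simp add: algebra_simps)
next
  case False
  with assms have "0 < x" by simp
  have deriv: "((\<lambda>z. z powr p) has_real_derivative p * z powr (p - 1)) (at z)" if "0 < z" for z
    using that by (rule has_real_derivative_powr)
  consider "x < y" | "y < x" using assms by linarith
  then show ?thesis
  proof cases
    case 1
    then obtain z where z: "x < z" "z < y" "y powr p - x powr p = (y - x) * (p * z powr (p - 1))"
      using MVT2[of x y "\<lambda>z. z powr p" "\<lambda>z. p * z powr (p - 1)"] deriv \<open>0 < x\<close>
      by (meson less_le_trans)
    have "(y - x) * (p * z powr (p - 1)) < (y - x) * (p * y powr (p - 1))"
      using z assms \<open>0 < x\<close> 1 by (intro mult_strict_left_mono powr_less_mono2) auto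
    with z show ?thesis by (simp add: algebra_simps)
  next
    case 2
    then obtain z where z: "y < z" "z < x" "x powr p - y powr p = (x - y) * (p * z powr (p - 1))"
      using MVT2[of y x "\<lambda>z. z powr p" "\<lambda>z. p * z powr (p - 1)"] deriv \<open>0 < y\<close>
      by (meson less_le_trans)
    have "(x - y) * (p * y powr (p - 1)) < (x - y) * (p * z powr (p - 1))"
      using z assms 2 by (intro mult_strict_left_mono powr_less_mono2) auto
    with z show ?thesis by (simp add: algebra_simps)
  qed
qed

text \<open>Averaging the tangent inequalities at the mean \<open>m\<close>, taken at
  \<open>a\<close> and \<open>b\<close> with weights \<open>c\<close> and \<open>1 - c\<close>,
  cancels the linear terms.\<close>

lemma powr_strict_convex:
  fixes a b c p :: real
  assumes "0 \<le> a" "0 \<le> b" "a \<noteq> b" "0 < c" "c < 1" "1 < p"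
  shows "(c * a + (1 - c) * b) powr p < c * a powr p + (1 - c) * b powr p"
proof -
  define m where "m = c * a + (1 - c) * b"
  have m: "0 < m"
  proof (cases "a = 0")
    case True
    then show ?thesis using assms by (simp add: m_def)
  next
    case False
    then show ?thesis unfolding m_def using assms by (intro add_pos_nonneg) auto
  qed
  \<comment> \<open>These identities show that \<open>m\<close> differs from both end points, so
    both tangent inequalities are strict.\<close>
  have "m - a = (1 - c) * (b - a)" "m - b = c * (a - b)"
    by (auto simp: m_def algebra_simps)
  then have "a \<noteq> m" "b \<noteq> m" using assms by auto
  then have "c * (m powr p + p * m powr (p - 1) * (a - m)) < c * a powr p"
    "(1 - c) * (m powr p + p * m powr (p - 1) * (b - m)) < (1 - c) * b powr p"
    using m assms by (auto intro!: mult_strict_left_mono powr_tangent_less)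
  then have "c * (m powr p + p * m powr (p - 1) * (a - m)) +
      (1 - c) * (m powr p + p * m powr (p - 1) * (b - m)) < c * a powr p + (1 - c) * b powr p"
    by linarith
  moreover have "c * (m powr p + p * m powr (p - 1) * (a - m)) +
      (1 - c) * (m powr p + p * m powr (p - 1) * (b - m))
      = m powr p + p * m powr (p - 1) * (c * a + (1 - c) * b - m)"
    by (simp add: algebra_simps)
  ultimately show ?thesis by (simp add: m_def)
qed

lemma powr_convex_le:
  fixes a b c p :: real
  assumes "0 \<le> a" "0 \<le> b" "0 < c" "c < 1" "1 < p"
  shows "(c * a + (1 - c) * b) powr p \<le> c * a powr p + (1 - c) * b powr p"
proof (cases "a = b")
  case True
  then show ?thesis by (simp flip: distrib_right)
next
  case False
  then show ?thesis using powr_strict_convex[of a b c p] assms by simp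
qed

text \<open>Rescaling to the unit sphere and taking \<epsilon> to be the distance of the rescaled
  points extracts strict convexity, the form in which the geometry of the target space
  enters.\<close>

lemma uniformly_convex_norm_add_less:
  fixes x y :: "'b::real_normed_vector"
  assumes "uniformly_convex TYPE('b)" "norm x = norm y" "x \<noteq> y"
  shows "norm (x + y) < 2 * norm x"
proof -
  define n where "n = norm x"
  have n: "0 < n" using assms by (auto simp: n_def)
  define u v where "u = (1/n) *\<^sub>R x" and "v = (1/n) *\<^sub>R y"
  have uv: "norm u = 1" "norm v = 1" "norm (u - v) > 0"
    using n assms by (auto simp: u_def v_def n_def)
  then obtain d where "0 < d" "norm ((1/2) *\<^sub>R (u + v)) \<le> 1 - d"
    using assms(1) unfolding uniformly_convex_def by blast
  then have "norm (u + v) < 2" by simp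
  moreover have "norm (x + y) = n * norm (u + v)"
    using n by (simp add: u_def v_def flip: scaleR_add_right)
  ultimately show ?thesis using n by (simp add: n_def)
qed

text \<open>The triangle inequality followed by convexity of the real power, valid in any normed
  space. Integrated, it gives closure of \<open>Lp_fun\<close> under addition and Minkowski's
  inequality.\<close>

lemma norm_powr_convex_le:
  fixes x y :: "'b::real_normed_vector"
  assumes "0 < c" "c < 1" "1 < p"
  shows "norm (c *\<^sub>R x + (1 - c) *\<^sub>R y) powr p \<le> c * norm x powr p + (1 - c) * norm y powr p"
proof -
  have "norm (c *\<^sub>R x + (1 - c) *\<^sub>R y) \<le> c * norm x + (1 - c) * norm y"
    using assms norm_triangle_ineq[of "c *\<^sub>R x" "(1 - c) *\<^sub>R y"] by simp
  then have "norm (c *\<^sub>R x + (1 - c) *\<^sub>R y) powr p \<le> (c * norm x + (1 - c) * norm y) powr p"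
    using assms by (intro powr_mono2) auto
  also have "\<dots> \<le> c * norm x powr p + (1 - c) * norm y powr p"
    using assms by (intro powr_convex_le) auto
  finally show ?thesis .
qed

text \<open>Strictness has two sources: for equal norms it comes from uniform convexity of the
  space, for different norms from strict convexity of the real power.\<close>

lemma norm_powr_midpoint_less:
  fixes x y :: "'b::real_normed_vector"
  assumes "uniformly_convex TYPE('b)" "1 < p" "x \<noteq> y"
  shows "norm ((1/2) *\<^sub>R (x + y)) powr p < (norm x powr p + norm y powr p) / 2"
proof (cases "norm x = norm y")
  case True
  then have "norm ((1/2) *\<^sub>R (x + y)) < norm x"
    using uniformly_convex_norm_add_less[OF assms(1)] assms by fastforce
  then have "norm ((1/2) *\<^sub>R (x + y)) powr p < norm x powr p"
    using assms by (intro powr_less_mono2) auto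
  with True show ?thesis by simp
next
  case False
  have "norm ((1/2) *\<^sub>R (x + y)) \<le> 1/2 * norm x + (1 - 1/2) * norm y"
    using norm_triangle_ineq[of x y] by simp
  then have "norm ((1/2) *\<^sub>R (x + y)) powr p \<le> (1/2 * norm x + (1 - 1/2) * norm y) powr p"
    using assms by (intro powr_mono2) auto
  also have "\<dots> < 1/2 * norm x powr p + (1 - 1/2) * norm y powr p"
    using assms False by (intro powr_strict_convex) auto
  finally show ?thesis by (simp add: field_simps)
qed

subsection \<open>Representatives of elements of \<open>L\<^sub>p\<close>\<close>

lemma strongly_measurable_borel:
  "strongly_measurable M f \<Longrightarrow> f \<in> borel_measurable M"
  unfolding strongly_measurable_def
  by (blast intro: borel_measurable_LIMSEQ_metric borel_measurable_simple_function)

lemma strongly_measurable_add: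
  assumes "strongly_measurable M f" "strongly_measurable M g"
  shows "strongly_measurable M (\<lambda>s. f s + g s)"
proof -
  from assms obtain u v where
    "\<And>n::nat. simple_function M (u n)" "\<And>s. s \<in> space M \<Longrightarrow> (\<lambda>n. u n s) \<longlonglongrightarrow> f s"
    "\<And>n::nat. simple_function M (v n)" "\<And>s. s \<in> space M \<Longrightarrow> (\<lambda>n. v n s) \<longlonglongrightarrow> g s"
    unfolding strongly_measurable_def by metis
  then show ?thesis
    unfolding strongly_measurable_def
    by (intro exI[of _ "\<lambda>n s. u n s + v n s"]) (auto intro: tendsto_add)
qed

lemma strongly_measurable_scale:
  assumes "strongly_measurable M f"
  shows "strongly_measurable M (\<lambda>s. c *\<^sub>R f s)"
proof -
  from assms obtain u where
    "\<And>n::nat. simple_function M (u n)" "\<And>s. s \<in> space M \<Longrightarrow> (\<lambda>n. u n s) \<longlonglongrightarrow> f s"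
    unfolding strongly_measurable_def by metis
  then show ?thesis
    unfolding strongly_measurable_def
    by (intro exI[of _ "\<lambda>n s. c *\<^sub>R u n s"]) (auto intro: tendsto_intros simple_function_compose1)
qed

lemma strongly_measurable_restrict:
  assumes "strongly_measurable M f" "A \<in> sets M"
  shows "strongly_measurable M (\<lambda>s. if s \<in> A then f s else 0)"
proof -
  from assms obtain u where
    "\<And>n::nat. simple_function M (u n)" "\<And>s. s \<in> space M \<Longrightarrow> (\<lambda>n. u n s) \<longlonglongrightarrow> f s"
    unfolding strongly_measurable_def by metis
  then show ?thesis
    unfolding strongly_measurable_def using assms(2)
    by (intro exI[of _ "\<lambda>n s. if s \<in> A then u n s else 0"])
       (auto intro: simple_function_If_set simp: sets.Int_space_eq2)
qed

text \<open>Trades the finite nonnegative integral for \<open>integrable\<close>, so that linearity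
  and monotonicity of the Bochner integral become available.\<close>

lemma Lp_fun_iff:
  "f \<in> Lp_fun M p \<longleftrightarrow> strongly_measurable M f \<and> integrable M (\<lambda>s. norm (f s) powr p)"
proof -
  have "integrable M (\<lambda>s. norm (f s) powr p) \<longleftrightarrow>
      (\<integral>\<^sup>+ s. ennreal (norm (f s) powr p) \<partial>M) < \<infinity>" if "strongly_measurable M f"
    using strongly_measurable_borel[OF that] by (simp add: integrable_iff_bounded)
  then show ?thesis by (auto simp: Lp_fun_def)
qed

lemma Lp_fun_integrable: "f \<in> Lp_fun M p \<Longrightarrow> integrable M (\<lambda>s. norm (f s) powr p)"
  by (simp add: Lp_fun_iff)

lemma Lp_fun_scale:
  assumes "f \<in> Lp_fun M p"
  shows "(\<lambda>s. c *\<^sub>R f s) \<in> Lp_fun M p"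
  using assms by (simp add: Lp_fun_iff strongly_measurable_scale powr_mult)

lemma Lp_fun_dominated:
  assumes "strongly_measurable M f" "integrable M k" "\<And>s. norm (f s) powr p \<le> k s"
  shows "f \<in> Lp_fun M p"
proof -
  have "integrable M (\<lambda>s. norm (f s) powr p)"
    using assms(2)
  proof (rule Bochner_Integration.integrable_bound)
    show "(\<lambda>s. norm (f s) powr p) \<in> borel_measurable M"
      using strongly_measurable_borel[OF assms(1)] by simp
    show "AE s in M. norm (norm (f s) powr p) \<le> norm (k s)"
      using assms(3) by (auto intro: order_trans[OF _ abs_ge_self])
  qed
  with assms(1) show ?thesis by (simp add: Lp_fun_iff)
qed

lemma Lp_fun_restrict:
  assumes "f \<in> Lp_fun M p" "A \<in> sets M" 
  shows "(\<lambda>s. if s \<in> A then f s else 0) \<in> Lp_fun M p"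
  using assms
  by (intro Lp_fun_dominated[where k = "\<lambda>s. norm (f s) powr p"])
     (auto simp: Lp_fun_iff strongly_measurable_restrict)

text \<open>Convexity of the power bounds the midpoint of \<open>f\<close> and \<open>g\<close> by
  an integrable function; the sum is twice the midpoint.\<close>

lemma Lp_fun_add:
  assumes "f \<in> Lp_fun M p" "g \<in> Lp_fun M p" "1 < p"
  shows "(\<lambda>s. f s + g s) \<in> Lp_fun M p"
proof -
  have "(\<lambda>s. (1/2) *\<^sub>R f s + (1 - 1/2) *\<^sub>R g s) \<in> Lp_fun M p"
  proof (rule Lp_fun_dominated)
    show "integrable M (\<lambda>s. 1/2 * norm (f s) powr p + (1 - 1/2) * norm (g s) powr p)"
      using assms Lp_fun_integrable[of f M p] Lp_fun_integrable[of g M p] by auto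
    show "norm ((1/2) *\<^sub>R f s + (1 - 1/2) *\<^sub>R g s) powr p
        \<le> 1/2 * norm (f s) powr p + (1 - 1/2) * norm (g s) powr p" for s
      using assms by (intro norm_powr_convex_le) auto
    show "strongly_measurable M (\<lambda>s. (1/2) *\<^sub>R f s + (1 - 1/2) *\<^sub>R g s)"
      using assms by (intro strongly_measurable_add strongly_measurable_scale) (auto simp: Lp_fun_iff)
  qed
  from Lp_fun_scale[OF this, of 2] show ?thesis by (simp add: scaleR_add_right)
qed

lemma Lp_fun_diff:
  assumes "f \<in> Lp_fun M p" "g \<in> Lp_fun M p" "1 < p"
  shows "(\<lambda>s. f s - g s) \<in> Lp_fun M p"
  using Lp_fun_add[OF assms(1) Lp_fun_scale[OF assms(2), of "-1"] assms(3)] by simp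

section \<open>The seminorm on representatives: Minkowski's inequality and strict convexity\<close>

definition Lp_seminorm :: "'a measure \<Rightarrow> real \<Rightarrow> ('a \<Rightarrow> 'b::real_normed_vector) \<Rightarrow> real" where
  "Lp_seminorm M p f = (\<integral>s. norm (f s) powr p \<partial>M) powr (1 / p)"

lemma Lp_seminorm_nonneg: "0 \<le> Lp_seminorm M p f"
  by (simp add: Lp_seminorm_def)

lemma Lp_seminorm_powr:
  assumes "1 < p"
  shows "Lp_seminorm M p f powr p = (\<integral>s. norm (f s) powr p \<partial>M)"
  using assms by (simp add: Lp_seminorm_def powr_powr)

lemma Lp_seminorm_cong_AE:
  assumes "f \<in> Lp_fun M p" "g \<in> Lp_fun M p" "AE s in M. norm (f s) = norm (g s)"
  shows "Lp_seminorm M p f = Lp_seminorm M p g"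
proof -
  have "(\<integral>s. norm (f s) powr p \<partial>M) = (\<integral>s. norm (g s) powr p \<partial>M)"
    using assms by (intro integral_cong_AE) (auto simp: Lp_fun_iff)
  then show ?thesis by (simp add: Lp_seminorm_def)
qed

lemma Lp_seminorm_scale:
  assumes "1 < p"
  shows "Lp_seminorm M p (\<lambda>s. c *\<^sub>R f s) = \<bar>c\<bar> * Lp_seminorm M p f"
  using assms by (simp add: Lp_seminorm_def powr_mult powr_powr)

lemma Lp_seminorm_eq_0_AE:
  assumes "f \<in> Lp_fun M p" "1 < p" "Lp_seminorm M p f = 0"
  shows "AE s in M. f s = 0"
proof -
  have "(\<integral>s. norm (f s) powr p \<partial>M) = 0"
    using assms Lp_seminorm_powr[of p M f] by simp
  then have "AE s in M. norm (f s) powr p = 0"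
    using assms integral_nonneg_eq_0_iff_AE[OF Lp_fun_integrable[OF assms(1)]] by simp
  then show ?thesis by simp
qed

text \<open>Minkowski's inequality by normalisation: \<open>f + g\<close> divided by
  \<open>a + b\<close> is a convex combination of the normalised functions \<open>f / a\<close> and
  \<open>g / b\<close>, and integrating convexity of the power bounds its seminorm by 1. If
  \<open>a\<close> or \<open>b\<close> is zero, the corresponding function vanishes almost
  everywhere.\<close>

lemma Lp_seminorm_triangle:
  assumes f: "f \<in> Lp_fun M p" and g: "g \<in> Lp_fun M p" and p: "1 < p"
  shows "Lp_seminorm M p (\<lambda>s. f s + g s) \<le> Lp_seminorm M p f + Lp_seminorm M p g"
proof -
  define a b where "a = Lp_seminorm M p f" and "b = Lp_seminorm M p g"
  have ab: "0 \<le> a" "0 \<le> b" by (auto simp: a_def b_def Lp_seminorm_nonneg)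
  have fg: "(\<lambda>s. f s + g s) \<in> Lp_fun M p" by (rule Lp_fun_add[OF f g p])
  consider "a = 0" | "b = 0" | "0 < a" "0 < b" using ab by linarith
  then show ?thesis
  proof cases
    case 1
    then have "AE s in M. f s = 0" using Lp_seminorm_eq_0_AE[OF f p] by (simp add: a_def)
    then have "Lp_seminorm M p (\<lambda>s. f s + g s) = b"
      unfolding b_def by (intro Lp_seminorm_cong_AE fg g) auto
    with ab show ?thesis by (simp add: a_def b_def)
  next
    case 2
    then have "AE s in M. g s = 0" using Lp_seminorm_eq_0_AE[OF g p] by (simp add: b_def)
    then have "Lp_seminorm M p (\<lambda>s. f s + g s) = a"
      unfolding a_def by (intro Lp_seminorm_cong_AE fg f) auto
    with ab show ?thesis by (simp add: a_def b_def)
  next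
    case 3
    \<comment> \<open>This weight makes \<open>c / a\<close> and \<open>(1 - c) / b\<close> both
      equal to \<open>1 / (a + b)\<close>.\<close>
    define c where "c = a / (a + b)"
    have c: "0 < c" "c < 1" using 3 by (auto simp: c_def)
    let ?f = "\<lambda>s. (1/a) *\<^sub>R f s" and ?g = "\<lambda>s. (1/b) *\<^sub>R g s"
    have f': "?f \<in> Lp_fun M p" and g': "?g \<in> Lp_fun M p"
      using f g by (auto intro: Lp_fun_scale)
    have h': "(\<lambda>s. c *\<^sub>R ?f s + (1 - c) *\<^sub>R ?g s) \<in> Lp_fun M p"
      by (intro Lp_fun_add Lp_fun_scale f g p)
    have "Lp_seminorm M p ?f = 1" "Lp_seminorm M p ?g = 1"
      using 3 p by (simp_all only: Lp_seminorm_scale flip: a_def b_def) auto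
    then have 1: "(\<integral>s. norm (?f s) powr p \<partial>M) = 1" "(\<integral>s. norm (?g s) powr p \<partial>M) = 1"
      using Lp_seminorm_powr[OF p, of M ?f] Lp_seminorm_powr[OF p, of M ?g] by simp_all
    have "(\<integral>s. norm (c *\<^sub>R ?f s + (1 - c) *\<^sub>R ?g s) powr p \<partial>M)
        \<le> (\<integral>s. c * norm (?f s) powr p + (1 - c) * norm (?g s) powr p \<partial>M)"
      using Lp_fun_integrable[OF f'] Lp_fun_integrable[OF g'] Lp_fun_integrable[OF h'] c p
      by (intro integral_mono norm_powr_convex_le) auto
    also have "\<dots> = c * (\<integral>s. norm (?f s) powr p \<partial>M) + (1 - c) * (\<integral>s. norm (?g s) powr p \<partial>M)"
      using Lp_fun_integrable[OF f'] Lp_fun_integrable[OF g'] 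
      by (subst Bochner_Integration.integral_add) auto
    also have "\<dots> = 1" unfolding 1 by simp
    finally have "(\<integral>s. norm (c *\<^sub>R ?f s + (1 - c) *\<^sub>R ?g s) powr p \<partial>M) powr (1/p) \<le> 1 powr (1/p)"
      using p by (intro powr_mono2) auto
    then have "Lp_seminorm M p (\<lambda>s. c *\<^sub>R ?f s + (1 - c) *\<^sub>R ?g s) \<le> 1"
      by (simp add: Lp_seminorm_def)
    moreover have "(\<lambda>s. c *\<^sub>R ?f s + (1 - c) *\<^sub>R ?g s) = (\<lambda>s. (1/(a+b)) *\<^sub>R (f s + g s))"
    proof -
      have "c * (1/a) = 1/(a+b)" "(1 - c) * (1/b) = 1/(a+b)"
        using 3 by (auto simp: c_def field_simps)
      then show ?thesis by (simp add: scaleR_add_right)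
    qed
    ultimately have "Lp_seminorm M p (\<lambda>s. (1/(a+b)) *\<^sub>R (f s + g s)) \<le> 1" by simp
    then have "\<bar>1/(a+b)\<bar> * Lp_seminorm M p (\<lambda>s. f s + g s) \<le> 1"
      by (simp only: Lp_seminorm_scale[OF p])
    then show ?thesis
      using 3 by (simp add: field_simps flip: a_def b_def)
  qed
qed

text \<open>The pointwise midpoint deficit \<open>?k\<close> is nonnegative and its integral is at
  most zero, so it vanishes almost everywhere; where it vanishes, the strict midpoint inequality
  forces \<open>f s = g s\<close>. This will give uniqueness of the projection.\<close>

lemma Lp_seminorm_strict_convex_AE:
  fixes f g :: "'a \<Rightarrow> 'b::real_normed_vector"
  assumes uc: "uniformly_convex TYPE('b)" and p: "1 < p"
    and f: "f \<in> Lp_fun M p" and g: "g \<in> Lp_fun M p"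
    and eq: "Lp_seminorm M p f = Lp_seminorm M p g"
    and le: "Lp_seminorm M p f \<le> Lp_seminorm M p (\<lambda>s. (1/2) *\<^sub>R (f s + g s))"
  shows "AE s in M. f s = g s"
proof -
  have m: "(\<lambda>s. (1/2) *\<^sub>R (f s + g s)) \<in> Lp_fun M p"
    by (intro Lp_fun_scale Lp_fun_add f g p)
  let ?k = "\<lambda>s. (norm (f s) powr p + norm (g s) powr p) / 2 - norm ((1/2) *\<^sub>R (f s + g s)) powr p"
  have k: "integrable M ?k"
    using Lp_fun_integrable[OF f] Lp_fun_integrable[OF g] Lp_fun_integrable[OF m] by auto
  have nn: "0 \<le> ?k s" for s
    using norm_powr_midpoint_less[OF uc p, of "f s" "g s"]
    by (cases "f s = g s") (auto simp flip: scaleR_2)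
  have "(\<integral>s. ?k s \<partial>M) = (Lp_seminorm M p f powr p + Lp_seminorm M p g powr p) / 2
      - Lp_seminorm M p (\<lambda>s. (1/2) *\<^sub>R (f s + g s)) powr p"
    unfolding Lp_seminorm_powr[OF p]
    using Lp_fun_integrable[OF f] Lp_fun_integrable[OF g] Lp_fun_integrable[OF m]
    by (subst Bochner_Integration.integral_diff) auto
  \<comment> \<open>By \<open>eq\<close> the average is the power of the seminorm of
    \<open>f\<close>, which by \<open>le\<close> does not exceed that of the midpoint.\<close>
  also have "\<dots> \<le> 0"
    using eq powr_mono2[OF _ Lp_seminorm_nonneg le, of p] p by simp
  finally have "(\<integral>s. ?k s \<partial>M) \<le> 0" .
  moreover have "0 \<le> (\<integral>s. ?k s \<partial>M)" using nn by (intro Bochner_Integration.integral_nonneg) simp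
  ultimately have "(\<integral>s. ?k s \<partial>M) = 0" by simp
  then have "AE s in M. ?k s = 0"
    using integral_nonneg_eq_0_iff_AE[OF k] nn by simp
  then show ?thesis
  proof eventually_elim
    case (elim s)
    then show ?case
      using norm_powr_midpoint_less[OF uc p, of "f s" "g s"] by argo
  qed
qed

subsection \<open>Passage to equivalence classes\<close>

lemma mem_Lp_class_iff:
  assumes "f \<in> Lp_fun M p"
  shows "g \<in> Lp_class M p f \<longleftrightarrow> g \<in> Lp_fun M p \<and> (AE s in M. f s = g s)"
  using assms by (auto simp: Lp_class_def Lp_rel_def)

lemma Lp_class_self: "f \<in> Lp_fun M p \<Longrightarrow> f \<in> Lp_class M p f"
  by (simp add: mem_Lp_class_iff)

lemma Lp_class_eqI:
  assumes "f \<in> Lp_fun M p" "g \<in> Lp_fun M p" "AE s in M. f s = g s"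
  shows "Lp_class M p f = Lp_class M p g"
proof -
  have "(AE s in M. f s = k s) \<longleftrightarrow> (AE s in M. g s = k s)" for k
  proof
    assume "AE s in M. f s = k s"
    with assms(3) show "AE s in M. g s = k s" by eventually_elim simp
  next
    assume "AE s in M. g s = k s"
    with assms(3) show "AE s in M. f s = k s" by eventually_elim simp
  qed
  then show ?thesis using assms by (auto simp: mem_Lp_class_iff)
qed

lemma Lp_class_in_Lp: "f \<in> Lp_fun M p \<Longrightarrow> Lp_class M p f \<in> Lp M p"
  unfolding Lp_def Lp_class_def by (rule quotientI)

lemma Lp_cases:
  assumes "F \<in> Lp M p"
  obtains f where "f \<in> Lp_fun M p" "F = Lp_class M p f"
  using assms unfolding Lp_def Lp_class_def by (rule quotientE)

text \<open>All representatives have the same seminorm, so the image in \<open>Lp_norm\<close> is a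
  singleton and \<open>the_elem\<close> returns its element.\<close>

lemma Lp_norm_class:
  assumes "f \<in> Lp_fun M p"
  shows "Lp_norm M p (Lp_class M p f) = Lp_seminorm M p f"
proof -
  have "Lp_seminorm M p k = Lp_seminorm M p f" if "k \<in> Lp_class M p f" for k
  proof -
    from that assms have k: "k \<in> Lp_fun M p" "AE s in M. f s = k s"
      by (auto simp: mem_Lp_class_iff)
    from k(2) have "AE s in M. norm (k s) = norm (f s)" by eventually_elim simp
    then show ?thesis by (rule Lp_seminorm_cong_AE[OF k(1) assms])
  qed
  then have "Lp_seminorm M p ` Lp_class M p f = {Lp_seminorm M p f}"
    using Lp_class_self[OF assms] by blast
  moreover have "Lp_norm M p F = the_elem (Lp_seminorm M p ` F)" for F :: "('a \<Rightarrow> 'b) set"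
    unfolding Lp_norm_def Lp_seminorm_def ..
  ultimately show ?thesis by simp
qed

text \<open>Collapses the unions over representatives by which the operations on classes are
  defined, once independence of the representative is known.\<close>

lemma UN_Lp_class:
  assumes "f \<in> Lp_fun M p"
    and "\<And>k. k \<in> Lp_fun M p \<Longrightarrow> AE s in M. f s = k s \<Longrightarrow> T k = T f"
  shows "(\<Union>k\<in>Lp_class M p f. T k) = T f"
proof -
  have "T k = T f" if "k \<in> Lp_class M p f" for k
    using that assms(2)[of k] by (simp add: mem_Lp_class_iff[OF assms(1)])
  then show ?thesis using Lp_class_self[OF assms(1)] by blast
qed

lemma Lp_add_class:
  assumes f: "f \<in> Lp_fun M p" and g: "g \<in> Lp_fun M p" and p: "1 < p"
  shows "Lp_add M p (Lp_class M p f) (Lp_class M p g) = Lp_class M p (\<lambda>s. f s + g s)"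
proof -
  \<comment> \<open>The inner union is collapsed for an arbitrary \<open>f'\<close>, because the
    outer union still ranges over all representatives of the first class.\<close>
  have "(\<Union>k\<in>Lp_class M p g. Lp_class M p (\<lambda>s. f' s + k s)) = Lp_class M p (\<lambda>s. f' s + g s)"
    if "f' \<in> Lp_fun M p" for f'
    using that by (intro UN_Lp_class g Lp_class_eqI Lp_fun_add p) auto
  then have "Lp_add M p (Lp_class M p f) (Lp_class M p g)
      = (\<Union>k\<in>Lp_class M p f. Lp_class M p (\<lambda>s. k s + g s))"
    using f by (simp add: Lp_add_def mem_Lp_class_iff)
  also have "\<dots> = Lp_class M p (\<lambda>s. f s + g s)"
    by (intro UN_Lp_class f Lp_class_eqI Lp_fun_add g p) auto
  finally show ?thesis .
qed

lemma Lp_diff_class: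
  assumes f: "f \<in> Lp_fun M p" and g: "g \<in> Lp_fun M p" and p: "1 < p"
  shows "Lp_diff M p (Lp_class M p f) (Lp_class M p g) = Lp_class M p (\<lambda>s. f s - g s)"
proof -
  have "(\<Union>k\<in>Lp_class M p g. Lp_class M p (\<lambda>s. f' s - k s)) = Lp_class M p (\<lambda>s. f' s - g s)"
    if "f' \<in> Lp_fun M p" for f'
    using that by (intro UN_Lp_class g Lp_class_eqI Lp_fun_diff p) auto
  then have "Lp_diff M p (Lp_class M p f) (Lp_class M p g)
      = (\<Union>k\<in>Lp_class M p f. Lp_class M p (\<lambda>s. k s - g s))"
    using f by (simp add: Lp_diff_def mem_Lp_class_iff)
  also have "\<dots> = Lp_class M p (\<lambda>s. f s - g s)"
    by (intro UN_Lp_class f Lp_class_eqI Lp_fun_diff g p) auto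
  finally show ?thesis .
qed

lemma Lp_scale_class:
  assumes "f \<in> Lp_fun M p"
  shows "Lp_scale M p c (Lp_class M p f) = Lp_class M p (\<lambda>s. c *\<^sub>R f s)"
  unfolding Lp_scale_def
  by (intro UN_Lp_class assms Lp_class_eqI Lp_fun_scale) auto

lemma Lp_restr_class:
  assumes "f \<in> Lp_fun M p" "A \<in> sets M"
  shows "Lp_restr M p A (Lp_class M p f) = Lp_class M p (\<lambda>s. if s \<in> A then f s else 0)"
  unfolding Lp_restr_def
  by (intro UN_Lp_class assms Lp_class_eqI Lp_fun_restrict) auto

text \<open>\<open>Lp_on\<close> quantifies over all representatives; testing one suffices because
  they agree almost everywhere.\<close>

lemma Lp_class_in_Lp_on_iff:
  assumes "f \<in> Lp_fun M p"
  shows "Lp_class M p f \<in> Lp_on M p A \<longleftrightarrow> (AE s in M. s \<notin> A \<longrightarrow> f s = 0)"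
proof
  assume "Lp_class M p f \<in> Lp_on M p A"
  then show "AE s in M. s \<notin> A \<longrightarrow> f s = 0"
    using Lp_class_self[OF assms] by (auto simp: Lp_on_def)
next
  assume *: "AE s in M. s \<notin> A \<longrightarrow> f s = 0"
  have "AE s in M. s \<notin> A \<longrightarrow> k s = 0" if "AE s in M. f s = k s" for k
    using * that by eventually_elim auto
  then show "Lp_class M p f \<in> Lp_on M p A"
    using Lp_class_in_Lp[OF assms] assms by (auto simp: Lp_on_def mem_Lp_class_iff)
qed

lemma Lp_class_restrict_eq:
  assumes "f \<in> Lp_fun M p" "A \<in> sets M" "Lp_class M p f \<in> Lp_on M p A"
  shows "Lp_class M p (\<lambda>s. if s \<in> A then f s else 0) = Lp_class M p f"
  using assms(3) unfolding Lp_class_in_Lp_on_iff[OF assms(1)]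
  by (intro Lp_class_eqI Lp_fun_restrict assms(1,2)) auto

lemma Lp_class_in_cball_iff:
  assumes "f \<in> Lp_fun M p"
  shows "Lp_class M p f \<in> Lp_cball M p A r
    \<longleftrightarrow> (AE s in M. s \<notin> A \<longrightarrow> f s = 0) \<and> Lp_seminorm M p f \<le> r"
  using assms by (simp add: Lp_cball_def Lp_class_in_Lp_on_iff Lp_norm_class)

subsection \<open>Projection onto the ball\<close>

text \<open>The scalar by which the radial retraction onto the ball of radius \<open>r\<close>
  multiplies a function of norm \<open>n\<close>. For \<open>r > 0\<close> the quotient is reached
  only with \<open>n > 0\<close>.\<close>

definition ball_factor :: "real \<Rightarrow> real \<Rightarrow> real" where
  "ball_factor r n = (if n \<le> r then 1 else r / n)"

text \<open>On \<open>A\<close> the second summand vanishes, off \<open>A\<close> the first one does.\<close>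

lemma Lp_seminorm_split:
  assumes f: "f \<in> Lp_fun M p" and z: "z \<in> Lp_fun M p" and p: "1 < p" and A: "A \<in> sets M"
    and z0: "AE s in M. s \<notin> A \<longrightarrow> z s = 0"
  shows "Lp_seminorm M p (\<lambda>s. f s - z s) powr p
    = Lp_seminorm M p (\<lambda>s. (if s \<in> A then f s else 0) - z s) powr p
      + Lp_seminorm M p (\<lambda>s. f s - (if s \<in> A then f s else 0)) powr p"
proof -
  let ?f = "\<lambda>s. if s \<in> A then f s else 0"
  have fA: "?f \<in> Lp_fun M p" using f A by (rule Lp_fun_restrict)
  note i = Lp_fun_integrable[OF Lp_fun_diff[OF f z p]] Lp_fun_integrable[OF Lp_fun_diff[OF fA z p]]
    Lp_fun_integrable[OF Lp_fun_diff[OF f fA p]]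
  have "(\<integral>s. norm (f s - z s) powr p \<partial>M)
      = (\<integral>s. norm (?f s - z s) powr p + norm (f s - ?f s) powr p \<partial>M)"
    using i z0 by (intro integral_cong_AE borel_measurable_add borel_measurable_integrable) auto
  also have "\<dots> = (\<integral>s. norm (?f s - z s) powr p \<partial>M) + (\<integral>s. norm (f s - ?f s) powr p \<partial>M)"
    using i(2,3) by (rule Bochner_Integration.integral_add)
  finally show ?thesis by (simp only: Lp_seminorm_powr[OF p])
qed

text \<open>The candidate \<open>y\<close> is a nearest point to \<open>fA\<close> by the triangle
  inequality, hence to \<open>f\<close> by \<open>Lp_seminorm_split\<close>. Two nearest points must
  agree because their midpoint is also in the ball.\<close>

lemma Lp_proj_cball_class:
  fixes f :: "'a \<Rightarrow> 'b::real_normed_vector"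
  assumes uc: "uniformly_convex TYPE('b)" and p: "1 < p" and A: "A \<in> sets M" and r: "0 < r"
    and f: "f \<in> Lp_fun M p"
  defines "fA \<equiv> \<lambda>s. if s \<in> A then f s else 0"
  shows "Lp_proj M p (Lp_cball M p A r) (Lp_class M p f)
    = Lp_class M p (\<lambda>s. ball_factor r (Lp_seminorm M p fA) *\<^sub>R fA s)"
proof -
  define n c where "n = Lp_seminorm M p fA" and "c = ball_factor r n"
  define y where "y = (\<lambda>s. c *\<^sub>R fA s)"
  have fA: "fA \<in> Lp_fun M p" unfolding fA_def using f A by (rule Lp_fun_restrict)
  have y: "y \<in> Lp_fun M p" unfolding y_def by (intro Lp_fun_scale fA)
  have y0: "AE s in M. s \<notin> A \<longrightarrow> y s = 0" by (simp add: y_def fA_def)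
  have "0 \<le> n" by (simp add: n_def Lp_seminorm_nonneg)
  have "Lp_seminorm M p y = \<bar>c\<bar> * n"
    unfolding y_def n_def by (rule Lp_seminorm_scale[OF p])
  also have "\<dots> \<le> r" using r \<open>0 \<le> n\<close> by (auto simp: c_def ball_factor_def)
  finally have ny: "Lp_seminorm M p y \<le> r" .
  \<comment> \<open>Since \<open>y\<close> is a multiple of \<open>fA\<close>, its distance from
    \<open>fA\<close> is \<open>\<bar>1 - c\<bar> * n\<close>.\<close>
  have dist_y: "Lp_seminorm M p (\<lambda>s. fA s - y s) = max 0 (n - r)"
  proof -
    have "(\<lambda>s. fA s - y s) = (\<lambda>s. (1 - c) *\<^sub>R fA s)" by (simp add: y_def algebra_simps)
    then have "Lp_seminorm M p (\<lambda>s. fA s - y s) = \<bar>1 - c\<bar> * n"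
      unfolding n_def by (simp only: Lp_seminorm_scale[OF p])
    also have "\<dots> = max 0 (n - r)"
      using r by (auto simp: c_def ball_factor_def abs_if field_simps)
    finally show ?thesis .
  qed
  have min: "Lp_seminorm M p (\<lambda>s. f s - y s) \<le> Lp_seminorm M p (\<lambda>s. f s - z s)"
    if z: "z \<in> Lp_fun M p" "AE s in M. s \<notin> A \<longrightarrow> z s = 0" "Lp_seminorm M p z \<le> r" for z
  proof -
    \<comment> \<open>Writing \<open>fA\<close> as \<open>(fA - z) + z\<close> shows that no
      \<open>z\<close> in the ball is closer to \<open>fA\<close> than \<open>n - r\<close>.\<close>
    have "n \<le> Lp_seminorm M p (\<lambda>s. fA s - z s) + Lp_seminorm M p z"
      using Lp_seminorm_triangle[OF Lp_fun_diff[OF fA z(1) p] z(1) p] by (simp add: n_def)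
    then have "Lp_seminorm M p (\<lambda>s. fA s - y s) \<le> Lp_seminorm M p (\<lambda>s. fA s - z s)"
      unfolding dist_y using z(3) by (simp add: Lp_seminorm_nonneg)
    \<comment> \<open>Both powers carry the same summand from outside \<open>A\<close>, so only the
      distances from \<open>fA\<close> are compared.\<close>
    then have "Lp_seminorm M p (\<lambda>s. f s - y s) powr p \<le> Lp_seminorm M p (\<lambda>s. f s - z s) powr p"
      unfolding Lp_seminorm_split[OF f y p A y0] Lp_seminorm_split[OF f z(1) p A z(2)]
      using p by (auto simp: fA_def intro: powr_mono2 Lp_seminorm_nonneg)
    then show ?thesis
      using p Lp_seminorm_nonneg by (smt (verit) powr_less_mono2)
  qed
  let ?opt = "\<lambda>Y. Y \<in> Lp_cball M p A r \<and> (\<forall>Z\<in>Lp_cball M p A r.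
    Lp_norm M p (Lp_diff M p (Lp_class M p f) Y) \<le> Lp_norm M p (Lp_diff M p (Lp_class M p f) Z))"
  have cball: "\<exists>z. Z = Lp_class M p z \<and> z \<in> Lp_fun M p \<and> (AE s in M. s \<notin> A \<longrightarrow> z s = 0)
      \<and> Lp_seminorm M p z \<le> r" if "Z \<in> Lp_cball M p A r" for Z :: "('a \<Rightarrow> 'b) set"
  proof -
    from that have "Z \<in> Lp M p" by (simp add: Lp_cball_def Lp_on_def)
    then obtain z where "z \<in> Lp_fun M p" "Z = Lp_class M p z" by (rule Lp_cases)
    with that show ?thesis using Lp_class_in_cball_iff by blast
  qed
  have norm_diff: "Lp_norm M p (Lp_diff M p (Lp_class M p f) (Lp_class M p z))
      = Lp_seminorm M p (\<lambda>s. f s - z s)" if "z \<in> Lp_fun M p" for z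
    using that f p by (simp add: Lp_diff_class Lp_norm_class Lp_fun_diff)
  have y_ball: "Lp_class M p y \<in> Lp_cball M p A r"
    using y y0 ny by (simp add: Lp_class_in_cball_iff)
  have "Lp_proj M p (Lp_cball M p A r) (Lp_class M p f) = Lp_class M p y"
    unfolding Lp_proj_def
  proof (rule the_equality)
    show "?opt (Lp_class M p y)"
    proof (intro conjI y_ball ballI)
      fix Z :: "('a \<Rightarrow> 'b) set" assume "Z \<in> Lp_cball M p A r"
      with cball show "Lp_norm M p (Lp_diff M p (Lp_class M p f) (Lp_class M p y))
          \<le> Lp_norm M p (Lp_diff M p (Lp_class M p f) Z)"
        using min y norm_diff by fastforce
    qed
  next
    fix Y :: "('a \<Rightarrow> 'b) set" assume Y: "?opt Y"
    then obtain z where z: "Y = Lp_class M p z" "z \<in> Lp_fun M p"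
      "AE s in M. s \<notin> A \<longrightarrow> z s = 0" "Lp_seminorm M p z \<le> r"
      using cball by blast
    have "Lp_seminorm M p (\<lambda>s. f s - z s) \<le> Lp_seminorm M p (\<lambda>s. f s - y s)"
      unfolding norm_diff[OF y, symmetric] norm_diff[OF z(2), symmetric]
      using Y y_ball z(1) by blast
    with min[OF z(2-4)] have eq: "Lp_seminorm M p (\<lambda>s. f s - y s) = Lp_seminorm M p (\<lambda>s. f s - z s)"
      by simp
    \<comment> \<open>The midpoint \<open>m\<close> lies in the ball, so it is no closer to
      \<open>f\<close> than \<open>y\<close> is. But \<open>f - m\<close> is the midpoint of
      \<open>f - y\<close> and \<open>f - z\<close>, which have equal seminorm, and strict convexity
      makes these agree almost everywhere.\<close>
    define m where "m = (\<lambda>s. (1/2) *\<^sub>R (y s + z s))"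
    have m: "m \<in> Lp_fun M p" unfolding m_def by (intro Lp_fun_scale Lp_fun_add y z p)
    have m0: "AE s in M. s \<notin> A \<longrightarrow> m s = 0"
      using y0 z(3) by eventually_elim (simp add: m_def)
    have "Lp_seminorm M p m = (1/2) * Lp_seminorm M p (\<lambda>s. y s + z s)"
      unfolding m_def by (simp only: Lp_seminorm_scale[OF p])
    also have "\<dots> \<le> r"
      using Lp_seminorm_triangle[OF y z(2) p] ny z(4) by simp
    finally have "Lp_seminorm M p (\<lambda>s. f s - y s) \<le> Lp_seminorm M p (\<lambda>s. f s - m s)"
      by (rule min[OF m m0])
    also have "(\<lambda>s. f s - m s) = (\<lambda>s. (1/2) *\<^sub>R ((f s - y s) + (f s - z s)))"
    proof
      fix s
      have "(f s - y s) + (f s - z s) = (f s + f s) - (y s + z s)" by simp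
      then show "f s - m s = (1/2) *\<^sub>R ((f s - y s) + (f s - z s))"
        by (simp only: m_def scaleR_diff_right scaleR_half_double)
    qed
    finally have "AE s in M. f s - y s = f s - z s"
      by (rule Lp_seminorm_strict_convex_AE[OF uc p Lp_fun_diff[OF f y p] Lp_fun_diff[OF f z(2) p] eq])
    then show "Y = Lp_class M p y"
      unfolding z(1) by (intro Lp_class_eqI z y) auto
  qed
  then show ?thesis by (simp add: y_def c_def n_def)
qed

subsection \<open>Directional derivatives\<close>

text \<open>Convexity makes the difference quotient nondecreasing in \<open>t > 0\<close>, and it is
  bounded below by minus the seminorm of \<open>v\<close>; hence it converges to its
  infimum.\<close>

lemma Lp_seminorm_slope_tendsto:
  fixes x v :: "'a \<Rightarrow> 'b::real_normed_vector"
  assumes x: "x \<in> Lp_fun M p" and v: "v \<in> Lp_fun M p" and p: "1 < p"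
  obtains L where
    "((\<lambda>t. (Lp_seminorm M p (\<lambda>s. x s + t *\<^sub>R v s) - Lp_seminorm M p x) / t) \<longlongrightarrow> L) (at_right 0)"
proof -
  define n where "n t = Lp_seminorm M p (\<lambda>s. x s + t *\<^sub>R v s)" for t
  define q where "q t = (n t - Lp_seminorm M p x) / t" for t
  have xv: "(\<lambda>s. x s + t *\<^sub>R v s) \<in> Lp_fun M p" for t
    by (intro Lp_fun_add Lp_fun_scale x v p)
  have mono: "q a \<le> q b" if "0 < a" "a \<le> b" for a b
  proof -
    \<comment> \<open>With this \<open>c\<close> the point at parameter \<open>a\<close> is a convex
      combination of \<open>x\<close> and the point at parameter \<open>b\<close>.\<close>
    define c where "c = a / b"
    have c: "0 < c" "c \<le> 1" using that by (auto simp: c_def)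
    have "(\<lambda>s. x s + a *\<^sub>R v s) = (\<lambda>s. (1 - c) *\<^sub>R x s + c *\<^sub>R (x s + b *\<^sub>R v s))"
      using that by (auto simp: c_def algebra_simps)
    then have "n a \<le> Lp_seminorm M p (\<lambda>s. (1 - c) *\<^sub>R x s)
        + Lp_seminorm M p (\<lambda>s. c *\<^sub>R (x s + b *\<^sub>R v s))"
      unfolding n_def by (simp only: Lp_seminorm_triangle Lp_fun_scale x xv p)
    also have "\<dots> = (1 - c) * Lp_seminorm M p x + c * n b"
      using c by (simp add: Lp_seminorm_scale[OF p] n_def del: scaleR_add_right)
    finally have "n a - Lp_seminorm M p x \<le> c * (n b - Lp_seminorm M p x)"
      by (simp add: algebra_simps)
    with that show ?thesis by (simp add: q_def c_def field_simps)
  qed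
  have bound: "- Lp_seminorm M p v \<le> q t" if "0 < t" for t
  proof -
    have "x = (\<lambda>s. (x s + t *\<^sub>R v s) + (- t) *\<^sub>R v s)" by simp
    then have "Lp_seminorm M p x \<le> n t + Lp_seminorm M p (\<lambda>s. (- t) *\<^sub>R v s)"
      unfolding n_def using Lp_seminorm_triangle[OF xv[of t] Lp_fun_scale[OF v, of "- t"] p]
      by simp
    then have "Lp_seminorm M p x \<le> n t + t * Lp_seminorm M p v"
      using that by (simp add: Lp_seminorm_scale[OF p] del: scaleR_minus_left)
    with that show ?thesis by (simp add: q_def field_simps)
  qed
  \<comment> \<open>The intersection with \<open>UNIV\<close> is the shape of
    \<open>Lim_right_bound\<close>, which allows monotonicity on a smaller set.\<close>
  have "(q \<longlongrightarrow> Inf (q ` ({0<..} \<inter> UNIV))) (at 0 within ({0<..} \<inter> UNIV))"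
    using mono bound by (intro Lim_right_bound) auto
  then show ?thesis
    unfolding q_def[abs_def] n_def Int_UNIV_right by (rule that)
qed

text \<open>\<open>Lim\<close> is a definite description and denotes the limit only once convergence
  is known; \<open>L\<close> supplies it.\<close>

lemma Lp_smoothness_class:
  assumes x: "x \<in> Lp_fun M p" and v: "v \<in> Lp_fun M p" and p: "1 < p"
    and L: "((\<lambda>t. (Lp_seminorm M p (\<lambda>s. x s + t *\<^sub>R v s) - Lp_seminorm M p x) / t) \<longlongrightarrow> L) (at_right 0)"
  shows "Lp_smoothness M p (Lp_class M p x) (Lp_class M p v) = L"
  using tendsto_Lim[OF _ L] x v p
  by (simp add: Lp_smoothness_def Lp_scale_class Lp_add_class Lp_fun_scale Lp_fun_add Lp_norm_class)

text \<open>The product rule for the curve \<open>c t *\<^sub>R (fA + t *\<^sub>R hA)\<close>. It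
  reduces both regimes, inside and outside the ball, to two scalar limits: \<open>a\<close> for the
  factor and \<open>b\<close> for its difference quotient at zero.\<close>

lemma Lp_proj_cball_has_dir_deriv_class:
  fixes f h :: "'a \<Rightarrow> 'b::real_normed_vector"
  assumes uc: "uniformly_convex TYPE('b)" and p: "1 < p" and A: "A \<in> sets M" and r: "0 < r"
    and f: "f \<in> Lp_fun M p" and h: "h \<in> Lp_fun M p"
    and fA_def: "fA = (\<lambda>s. if s \<in> A then f s else 0)"
    and hA_def: "hA = (\<lambda>s. if s \<in> A then h s else 0)"
  defines "c \<equiv> \<lambda>t. ball_factor r (Lp_seminorm M p (\<lambda>s. fA s + t *\<^sub>R hA s))"
  assumes a: "(c \<longlongrightarrow> a) (at_right 0)" and b: "((\<lambda>t. (c t - c 0) / t) \<longlongrightarrow> b) (at_right 0)"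
  shows "Lp_has_dir_deriv M p (Lp_proj M p (Lp_cball M p A r)) (Lp_class M p f) (Lp_class M p h)
    (Lp_class M p (\<lambda>s. a *\<^sub>R hA s + b *\<^sub>R fA s))"
proof -
  have fA: "fA \<in> Lp_fun M p" and hA: "hA \<in> Lp_fun M p"
    unfolding fA_def hA_def using f h A by (auto intro: Lp_fun_restrict)
  note closed = Lp_fun_add Lp_fun_diff Lp_fun_scale f h fA hA p
  let ?P = "Lp_proj M p (Lp_cball M p A r)"
  let ?D = "\<lambda>s. a *\<^sub>R hA s + b *\<^sub>R fA s"
  let ?e = "\<lambda>t s. (c t - a) *\<^sub>R hA s + ((c t - c 0) / t - b) *\<^sub>R fA s"
  have P: "?P (Lp_class M p (\<lambda>s. f s + t *\<^sub>R h s)) = Lp_class M p (\<lambda>s. c t *\<^sub>R (fA s + t *\<^sub>R hA s))" for t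
  proof -
    have "(if s \<in> A then f s + t *\<^sub>R h s else 0) = fA s + t *\<^sub>R hA s" for s
      by (simp add: fA_def hA_def)
    then show ?thesis
      using Lp_proj_cball_class[OF uc p A r Lp_fun_add[OF f Lp_fun_scale[OF h] p], of t]
      by (simp only: c_def)
  qed
  have P0: "?P (Lp_class M p f) = Lp_class M p (\<lambda>s. c 0 *\<^sub>R fA s)"
    using P[of 0] by simp
  have quot: "Lp_norm M p (Lp_diff M p (Lp_scale M p (1 / t) (Lp_diff M p
      (?P (Lp_add M p (Lp_class M p f) (Lp_scale M p t (Lp_class M p h)))) (?P (Lp_class M p f))))
      (Lp_class M p ?D)) = Lp_seminorm M p (?e t)" if "0 < t" for t
  proof -
    have "Lp_diff M p (Lp_scale M p (1 / t) (Lp_diff M p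
      (?P (Lp_add M p (Lp_class M p f) (Lp_scale M p t (Lp_class M p h)))) (?P (Lp_class M p f))))
      (Lp_class M p ?D)
      = Lp_class M p (\<lambda>s. (1/t) *\<^sub>R (c t *\<^sub>R (fA s + t *\<^sub>R hA s) - c 0 *\<^sub>R fA s) - ?D s)"
      by (simp only: Lp_scale_class Lp_add_class Lp_diff_class P P0 closed)
    \<comment> \<open>The quotient is
      \<open>c t *\<^sub>R hA + ((c t - c 0) / t) *\<^sub>R fA\<close>, so the error splits into two
      fixed functions with scalar coefficients tending to zero.\<close>
    also have "(\<lambda>s. (1/t) *\<^sub>R (c t *\<^sub>R (fA s + t *\<^sub>R hA s) - c 0 *\<^sub>R fA s) - ?D s) = ?e t"
      using that by (auto simp: algebra_simps diff_divide_distrib)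
    finally show ?thesis by (simp only: Lp_norm_class closed)
  qed
  have "((\<lambda>t. Lp_seminorm M p (?e t)) \<longlongrightarrow> 0) (at_right 0)"
  proof (rule tendsto_sandwich)
    show "\<forall>\<^sub>F t in at_right 0. 0 \<le> Lp_seminorm M p (?e t)"
      by (simp add: Lp_seminorm_nonneg)
    show "\<forall>\<^sub>F t in at_right 0. Lp_seminorm M p (?e t)
        \<le> \<bar>c t - a\<bar> * Lp_seminorm M p hA + \<bar>(c t - c 0) / t - b\<bar> * Lp_seminorm M p fA"
      unfolding Lp_seminorm_scale[OF p, symmetric]
      by (intro always_eventually allI Lp_seminorm_triangle closed)
    have "((\<lambda>t. \<bar>c t - a\<bar> * Lp_seminorm M p hA + \<bar>(c t - c 0) / t - b\<bar> * Lp_seminorm M p fA)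
        \<longlongrightarrow> \<bar>a - a\<bar> * Lp_seminorm M p hA + \<bar>b - b\<bar> * Lp_seminorm M p fA) (at_right 0)"
      by (intro tendsto_intros a b)
    then show "((\<lambda>t. \<bar>c t - a\<bar> * Lp_seminorm M p hA + \<bar>(c t - c 0) / t - b\<bar> * Lp_seminorm M p fA)
        \<longlongrightarrow> 0) (at_right 0)" by simp
  qed simp
  moreover have "\<forall>\<^sub>F t in at_right (0::real). 0 < t" by (rule eventually_at_right_less)
  ultimately have "((\<lambda>t. Lp_norm M p (Lp_diff M p (Lp_scale M p (1 / t) (Lp_diff M p
      (?P (Lp_add M p (Lp_class M p f) (Lp_scale M p t (Lp_class M p h)))) (?P (Lp_class M p f))))
      (Lp_class M p ?D))) \<longlongrightarrow> 0) (at_right 0)"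
    by (elim Lim_transform_eventually) (auto elim!: eventually_mono simp: quot)
  moreover have "Lp_class M p ?D \<in> Lp M p"
    by (intro Lp_class_in_Lp closed)
  ultimately show ?thesis by (simp add: Lp_has_dir_deriv_def)
qed

text \<open>The value at \<open>t\<close> is the value at zero plus \<open>t\<close> times a
  convergent slope.\<close>

lemma Lp_seminorm_tendsto_at_right:
  assumes "x \<in> Lp_fun M p" "v \<in> Lp_fun M p" "1 < p"
  shows "((\<lambda>t. Lp_seminorm M p (\<lambda>s. x s + t *\<^sub>R v s)) \<longlongrightarrow> Lp_seminorm M p x) (at_right 0)"
proof -
  obtain L where
    "((\<lambda>t. (Lp_seminorm M p (\<lambda>s. x s + t *\<^sub>R v s) - Lp_seminorm M p x) / t) \<longlongrightarrow> L) (at_right 0)"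
    using Lp_seminorm_slope_tendsto[OF assms] .
  then have "((\<lambda>t. Lp_seminorm M p x
      + t * ((Lp_seminorm M p (\<lambda>s. x s + t *\<^sub>R v s) - Lp_seminorm M p x) / t))
      \<longlongrightarrow> Lp_seminorm M p x + 0 * L) (at_right 0)"
    by (intro tendsto_intros)
  then show ?thesis
    by (elim Lim_transform_eventually[THEN tendsto_eq_rhs])
       (auto intro: eventually_mono[OF eventually_at_right_less])
qed

text \<open>By right continuity the norm stays below \<open>r\<close> for small \<open>t\<close>, so
  the factor is eventually 1 and the scalar limits are \<open>a = 1\<close> and
  \<open>b = 0\<close>.\<close>

lemma Lp_proj_cball_has_dir_deriv_inside_class:
  fixes f h :: "'a \<Rightarrow> 'b::real_normed_vector"
  assumes uc: "uniformly_convex TYPE('b)" and p: "1 < p" and A: "A \<in> sets M" and r: "0 < r"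
    and f: "f \<in> Lp_fun M p" and h: "h \<in> Lp_fun M p"
    and less: "Lp_seminorm M p (\<lambda>s. if s \<in> A then f s else 0) < r"
  shows "Lp_has_dir_deriv M p (Lp_proj M p (Lp_cball M p A r)) (Lp_class M p f) (Lp_class M p h)
    (Lp_class M p (\<lambda>s. if s \<in> A then h s else 0))"
proof -
  let ?f = "\<lambda>s. if s \<in> A then f s else 0" and ?h = "\<lambda>s. if s \<in> A then h s else 0"
  let ?c = "\<lambda>t. ball_factor r (Lp_seminorm M p (\<lambda>s. ?f s + t *\<^sub>R ?h s))"
  have "\<forall>\<^sub>F t in at_right 0. Lp_seminorm M p (\<lambda>s. ?f s + t *\<^sub>R ?h s) < r"
    using order_tendstoD(2)[OF Lp_seminorm_tendsto_at_right less] Lp_fun_restrict f h A p by blast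
  then have c: "\<forall>\<^sub>F t in at_right 0. ?c t = 1"
    by eventually_elim (simp add: ball_factor_def)
  have c0: "?c 0 = 1" using less by (simp add: ball_factor_def)
  have "Lp_has_dir_deriv M p (Lp_proj M p (Lp_cball M p A r)) (Lp_class M p f) (Lp_class M p h)
      (Lp_class M p (\<lambda>s. 1 *\<^sub>R ?h s + 0 *\<^sub>R ?f s))"
  proof (rule Lp_proj_cball_has_dir_deriv_class[OF uc p A r f h refl refl])
    show "(?c \<longlongrightarrow> 1) (at_right 0)" using c by (rule tendsto_eventually)
    have "\<forall>\<^sub>F t in at_right 0. (?c t - ?c 0) / t = 0"
      using c unfolding c0 by eventually_elim simp
    then show "((\<lambda>t. (?c t - ?c 0) / t) \<longlongrightarrow> 0) (at_right 0)" by (rule tendsto_eventually)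
  qed
  then show ?thesis by simp
qed

text \<open>For small \<open>t\<close> the norm \<open>n t\<close> stays above \<open>r\<close>, so
  the factor is \<open>r / n t\<close>; its right derivative at zero is
  \<open>- r * L / (n 0 * n 0)\<close>.\<close>

lemma Lp_proj_cball_has_dir_deriv_outside_class:
  fixes f h :: "'a \<Rightarrow> 'b::real_normed_vector"
  assumes uc: "uniformly_convex TYPE('b)" and p: "1 < p" and A: "A \<in> sets M" and r: "0 < r"
    and f: "f \<in> Lp_fun M p" and h: "h \<in> Lp_fun M p"
    and fA_def: "fA = (\<lambda>s. if s \<in> A then f s else 0)"
    and hA_def: "hA = (\<lambda>s. if s \<in> A then h s else 0)"
    and less: "r < Lp_seminorm M p fA"
    and L: "((\<lambda>t. (Lp_seminorm M p (\<lambda>s. fA s + t *\<^sub>R hA s) - Lp_seminorm M p fA) / t) \<longlongrightarrow> L)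
      (at_right 0)"
  shows "Lp_has_dir_deriv M p (Lp_proj M p (Lp_cball M p A r)) (Lp_class M p f) (Lp_class M p h)
    (Lp_class M p (\<lambda>s. (r / Lp_seminorm M p fA) *\<^sub>R (hA s - (L / Lp_seminorm M p fA) *\<^sub>R fA s)))"
proof -
  have fA: "fA \<in> Lp_fun M p" and hA: "hA \<in> Lp_fun M p"
    unfolding fA_def hA_def using f h A by (auto intro: Lp_fun_restrict)
  define n where "n t = Lp_seminorm M p (\<lambda>s. fA s + t *\<^sub>R hA s)" for t
  have n0: "n 0 = Lp_seminorm M p fA" by (simp add: n_def)
  with less r have pos: "r < n 0" "0 < n 0" by auto
  have n: "(n \<longlongrightarrow> n 0) (at_right 0)"
    using Lp_seminorm_tendsto_at_right[OF fA hA p] by (simp add: n_def[abs_def])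
  have L: "((\<lambda>t. (n t - n 0) / t) \<longlongrightarrow> L) (at_right 0)"
    using L by (simp add: n_def)
  have ev: "\<forall>\<^sub>F t in at_right 0. r < n t" using order_tendstoD(1)[OF n pos(1)] .
  have "((\<lambda>t. r / n t) \<longlongrightarrow> r / n 0) (at_right 0)"
    using pos by (intro tendsto_intros n) auto
  then have lim: "((\<lambda>t. ball_factor r (n t)) \<longlongrightarrow> r / n 0) (at_right 0)"
    by (rule Lim_transform_eventually) (use ev in eventually_elim, simp add: ball_factor_def)
  \<comment> \<open>This is the difference quotient of \<open>r / n t\<close> over a common
    denominator, with the slope of \<open>n\<close> isolated.\<close>
  have "((\<lambda>t. - r * ((n t - n 0) / t) / (n t * n 0)) \<longlongrightarrow> - r * L / (n 0 * n 0)) (at_right 0)"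
    using pos by (intro tendsto_intros n L) auto
  then have slope: "((\<lambda>t. (ball_factor r (n t) - ball_factor r (n 0)) / t)
      \<longlongrightarrow> - r * L / (n 0 * n 0)) (at_right 0)"
  proof (rule Lim_transform_eventually)
    show "\<forall>\<^sub>F t in at_right 0. - r * ((n t - n 0) / t) / (n t * n 0)
        = (ball_factor r (n t) - ball_factor r (n 0)) / t"
      using ev eventually_at_right_less[of "0::real"]
    proof eventually_elim
      case (elim t)
      then show ?case using pos r by (simp add: ball_factor_def field_simps)
    qed
  qed
  have "Lp_has_dir_deriv M p (Lp_proj M p (Lp_cball M p A r)) (Lp_class M p f) (Lp_class M p h)
      (Lp_class M p (\<lambda>s. (r / n 0) *\<^sub>R hA s + (- r * L / (n 0 * n 0)) *\<^sub>R fA s))"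
    by (rule Lp_proj_cball_has_dir_deriv_class[OF uc p A r f h fA_def hA_def, folded n_def, OF lim slope])
  also have "(\<lambda>s. (r / n 0) *\<^sub>R hA s + (- r * L / (n 0 * n 0)) *\<^sub>R fA s)
      = (\<lambda>s. (r / n 0) *\<^sub>R (hA s - (L / n 0) *\<^sub>R fA s))"
    by (simp add: scaleR_diff_right)
  finally show ?thesis by (simp only: n0)
qed

section \<open>Derivative formulas for elements of \<open>Lp\<close>\<close>

lemma Lp_restr_eq_self:
  assumes "A \<in> sets M" "F \<in> Lp_on M p A"
  shows "Lp_restr M p A F = F"
proof -
  from assms(2) have "F \<in> Lp M p" by (simp add: Lp_on_def)
  then obtain f where f: "f \<in> Lp_fun M p" "F = Lp_class M p f" by (rule Lp_cases)
  with assms show ?thesis by (simp add: Lp_restr_class Lp_class_restrict_eq)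
qed

lemma Lp_restr_mem_Lp_on:
  assumes "A \<in> sets M" "F \<in> Lp M p"
  shows "Lp_restr M p A F \<in> Lp_on M p A"
proof -
  obtain f where f: "f \<in> Lp_fun M p" "F = Lp_class M p f" using assms(2) by (rule Lp_cases)
  have "Lp_class M p (\<lambda>s. if s \<in> A then f s else 0) \<in> Lp_on M p A"
    using Lp_class_in_Lp_on_iff[OF Lp_fun_restrict[OF f(1) assms(1)]] by simp
  with f assms(1) show ?thesis by (simp add: Lp_restr_class)
qed

text \<open>Serves the open ball and the open cylinder alike, since only the norm of the restriction
  to \<open>A\<close> matters.\<close>

lemma Lp_proj_cball_has_dir_deriv_inside:
  fixes F H :: "('a \<Rightarrow> 'b::real_normed_vector) set"
  assumes uc: "uniformly_convex TYPE('b)" and p: "1 < p" and A: "A \<in> sets M" and r: "0 < r"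
    and F: "F \<in> Lp M p" and H: "H \<in> Lp M p" and less: "Lp_norm M p (Lp_restr M p A F) < r"
  shows "Lp_has_dir_deriv M p (Lp_proj M p (Lp_cball M p A r)) F H (Lp_restr M p A H)"
proof -
  obtain f where f: "f \<in> Lp_fun M p" "F = Lp_class M p f" using F by (rule Lp_cases)
  obtain h where h: "h \<in> Lp_fun M p" "H = Lp_class M p h" using H by (rule Lp_cases)
  have "Lp_seminorm M p (\<lambda>s. if s \<in> A then f s else 0) < r"
    using less A f by (simp add: Lp_restr_class Lp_norm_class Lp_fun_restrict)
  from Lp_proj_cball_has_dir_deriv_inside_class[OF uc p A r f(1) h(1) this] show ?thesis
    using A f h by (simp add: Lp_restr_class)
qed

lemma Lp_proj_cball_has_dir_deriv_outside:
  fixes F H :: "('a \<Rightarrow> 'b::real_normed_vector) set"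
  assumes uc: "uniformly_convex TYPE('b)" and p: "1 < p" and A: "A \<in> sets M" and r: "0 < r"
    and F: "F \<in> Lp M p" and H: "H \<in> Lp M p"
  defines "FA \<equiv> Lp_restr M p A F" and "HA \<equiv> Lp_restr M p A H"
  assumes less: "r < Lp_norm M p FA"
  shows "Lp_has_dir_deriv M p (Lp_proj M p (Lp_cball M p A r)) F H
    (Lp_scale M p (r / Lp_norm M p FA)
      (Lp_diff M p HA (Lp_scale M p (Lp_smoothness M p FA HA / Lp_norm M p FA) FA)))"
proof -
  obtain f where f: "f \<in> Lp_fun M p" "F = Lp_class M p f" using F by (rule Lp_cases)
  obtain h where h: "h \<in> Lp_fun M p" "H = Lp_class M p h" using H by (rule Lp_cases)
  define fA hA where "fA = (\<lambda>s. if s \<in> A then f s else 0)" and "hA = (\<lambda>s. if s \<in> A then h s else 0)"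
  have fA: "fA \<in> Lp_fun M p" and hA: "hA \<in> Lp_fun M p"
    unfolding fA_def hA_def using f h A by (auto intro: Lp_fun_restrict)
  have FA: "FA = Lp_class M p fA" and HA: "HA = Lp_class M p hA"
    using f h A by (simp_all add: FA_def HA_def fA_def hA_def Lp_restr_class)
  obtain L where L: "((\<lambda>t. (Lp_seminorm M p (\<lambda>s. fA s + t *\<^sub>R hA s) - Lp_seminorm M p fA) / t)
      \<longlongrightarrow> L) (at_right 0)"
    using Lp_seminorm_slope_tendsto[OF fA hA p] .
  have norm: "Lp_norm M p FA = Lp_seminorm M p fA" unfolding FA by (rule Lp_norm_class[OF fA])
  have "Lp_smoothness M p FA HA = L"
    unfolding FA HA by (rule Lp_smoothness_class[OF fA hA p L])
  moreover have "r < Lp_seminorm M p fA" using less norm by simp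
  note Lp_proj_cball_has_dir_deriv_outside_class[OF uc p A r f(1) h(1) fA_def hA_def this L]
  ultimately show ?thesis
    unfolding f(2) h(2) norm
    by (simp only: FA HA Lp_scale_class Lp_diff_class Lp_fun_scale Lp_fun_diff fA hA p)
qed

text \<open>Along its own direction the norm of \<open>fA\<close> grows with slope \<open>n\<close>,
  the norm itself, so the bracket in the outside formula is \<open>fA - fA\<close>.\<close>

lemma Lp_proj_cball_has_dir_deriv_outside_self:
  fixes F :: "('a \<Rightarrow> 'b::real_normed_vector) set"
  assumes uc: "uniformly_convex TYPE('b)" and p: "1 < p" and A: "A \<in> sets M" and r: "0 < r"
    and F: "F \<in> Lp M p" and less: "r < Lp_norm M p (Lp_restr M p A F)"
  shows "Lp_has_dir_deriv M p (Lp_proj M p (Lp_cball M p A r)) F F (Lp_zero M p)"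
proof -
  obtain f where f: "f \<in> Lp_fun M p" "F = Lp_class M p f" using F by (rule Lp_cases)
  define fA where "fA = (\<lambda>s. if s \<in> A then f s else 0)"
  have fA: "fA \<in> Lp_fun M p" unfolding fA_def using f(1) A by (rule Lp_fun_restrict)
  define n where "n = Lp_seminorm M p fA"
  have n: "r < n"
    using less A f fA by (simp add: Lp_restr_class Lp_norm_class n_def flip: fA_def)
  have "Lp_seminorm M p (\<lambda>s. fA s + t *\<^sub>R fA s) = \<bar>1 + t\<bar> * n" for t
    using Lp_seminorm_scale[OF p, of M "1 + t" fA] by (simp add: n_def algebra_simps)
  then have "\<forall>\<^sub>F t in at_right 0. (Lp_seminorm M p (\<lambda>s. fA s + t *\<^sub>R fA s) - n) / t = n"
    by (intro eventually_mono[OF eventually_at_right_less]) (simp add: field_simps)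
  then have "((\<lambda>t. (Lp_seminorm M p (\<lambda>s. fA s + t *\<^sub>R fA s) - n) / t) \<longlongrightarrow> n) (at_right 0)"
    by (rule tendsto_eventually)
  from Lp_proj_cball_has_dir_deriv_outside_class[OF uc p A r f(1) f(1) fA_def fA_def, folded n_def, OF n this]
  show ?thesis using n r by (simp add: f(2) Lp_zero_def)
qed

section \<open>Assembly of the cases\<close>

theorem theorem5p4:
  fixes M :: "'a measure"
    and p r :: real
    and A :: "'a set"
    and g h :: "('a \<Rightarrow> 'b::banach) set"
  assumes "uniformly_convex TYPE('b)" and "uniformly_smooth TYPE('b)"
    and "1 < p"
    and "A \<in> sets M" and "emeasure M A > 0"
    and "r > 0"
    and "g \<in> Lp M p" and "h \<in> Lp M p" and "h \<noteq> Lp_zero M p"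
  shows
    "(g \<in> Lp_ball M p A r \<longrightarrow>
        Lp_has_dir_deriv M p (Lp_proj M p (Lp_cball M p A r)) g h
          (if h \<in> Lp_on M p A then h else Lp_restr M p A h))
     \<and>
     (g \<in> Lp_on M p A - Lp_cball M p A r \<longrightarrow>
        Lp_has_dir_deriv M p (Lp_proj M p (Lp_cball M p A r)) g h
          (if h \<in> Lp_on M p A
           then Lp_scale M p (r / Lp_norm M p g)
                  (Lp_diff M p h
                    (Lp_scale M p (Lp_smoothness M p g h / Lp_norm M p g) g))
           else Lp_scale M p (r / Lp_norm M p g)
                  (Lp_diff M p (Lp_restr M p A h)
                    (Lp_scale M p (Lp_smoothness M p g (Lp_restr M p A h) / Lp_norm M p g) g))))
     \<and>
     (\<forall>f \<in> Lp_on M p A - Lp_cball M p A r.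
        Lp_has_dir_deriv M p (Lp_proj M p (Lp_cball M p A r)) f f (Lp_zero M p :: ('a \<Rightarrow> 'b) set))
     \<and>
     (g \<in> Lp_cyl M p A r - Lp_on M p A \<longrightarrow>
        Lp_has_dir_deriv M p (Lp_proj M p (Lp_cball M p A r)) g h (Lp_restr M p A h))
     \<and>
     (g \<in> Lp M p - (Lp_ccyl M p A r \<union> Lp_on M p A) \<longrightarrow>
        Lp_has_dir_deriv M p (Lp_proj M p (Lp_cball M p A r)) g h
          (Lp_scale M p (r / Lp_norm M p (Lp_restr M p A g))
            (Lp_diff M p (Lp_restr M p A h)
              (Lp_scale M p
                (Lp_smoothness M p (Lp_restr M p A g) (Lp_restr M p A h)
                   / Lp_norm M p (Lp_restr M p A g))
                (Lp_restr M p A g)))))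
     \<and>
     (\<forall>f \<in> Lp M p - (Lp_ccyl M p A r \<union> Lp_on M p A).
        Lp_has_dir_deriv M p (Lp_proj M p (Lp_cball M p A r)) f f (Lp_zero M p :: ('a \<Rightarrow> 'b) set))"
proof -
  note uc = assms(1) and p = assms(3) and A = assms(4) and r = assms(6) and g = assms(7) and h = assms(8)
  \<comment> \<open>Restriction is the identity on \<open>Lp_on M p A\<close>, so both branches of
    each \<open>if\<close> are instances of one formula with
    \<open>Lp_restr M p A h\<close>.\<close>
  have restr_self: "Lp_restr M p A F = F" if "F \<in> Lp_on M p A" for F :: "('a \<Rightarrow> 'b) set"
    using Lp_restr_eq_self[OF A that] .
  have on_Lp: "F \<in> Lp M p" if "F \<in> Lp_on M p A" for F :: "('a \<Rightarrow> 'b) set"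
    using that by (simp add: Lp_on_def)
  have on_outside: "r < Lp_norm M p (Lp_restr M p A F)" if "F \<in> Lp_on M p A - Lp_cball M p A r"
    for F :: "('a \<Rightarrow> 'b) set"
    using that by (auto simp: Lp_cball_def restr_self)
  \<comment> \<open>The restriction always lies in \<open>Lp_on M p A\<close>, so membership in the
    closed cylinder can fail only through the norm.\<close>
  have outside: "r < Lp_norm M p (Lp_restr M p A F)" if "F \<in> Lp M p - (Lp_ccyl M p A r \<union> Lp_on M p A)"
    for F :: "('a \<Rightarrow> 'b) set"
    using that Lp_restr_mem_Lp_on[OF A, of F p] by (auto simp: Lp_ccyl_def Lp_cball_def)
  note inside_deriv = Lp_proj_cball_has_dir_deriv_inside[OF uc p A r g h]
    and outside_deriv = Lp_proj_cball_has_dir_deriv_outside[OF uc p A r g h]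
    and self_deriv = Lp_proj_cball_has_dir_deriv_outside_self[OF uc p A r]
  show ?thesis
  proof (intro conjI impI ballI)
    assume "g \<in> Lp_ball M p A r"
    then show "Lp_has_dir_deriv M p (Lp_proj M p (Lp_cball M p A r)) g h
        (if h \<in> Lp_on M p A then h else Lp_restr M p A h)"
      using inside_deriv by (auto simp: Lp_ball_def restr_self)
  next
    assume "g \<in> Lp_on M p A - Lp_cball M p A r"
    then show "Lp_has_dir_deriv M p (Lp_proj M p (Lp_cball M p A r)) g h
          (if h \<in> Lp_on M p A
           then Lp_scale M p (r / Lp_norm M p g)
                  (Lp_diff M p h
                    (Lp_scale M p (Lp_smoothness M p g h / Lp_norm M p g) g))
           else Lp_scale M p (r / Lp_norm M p g)
                  (Lp_diff M p (Lp_restr M p A h)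
                    (Lp_scale M p (Lp_smoothness M p g (Lp_restr M p A h) / Lp_norm M p g) g)))"
      using outside_deriv on_outside[of g] by (auto simp: restr_self)
  next
    fix f :: "('a \<Rightarrow> 'b) set" assume "f \<in> Lp_on M p A - Lp_cball M p A r"
    then show "Lp_has_dir_deriv M p (Lp_proj M p (Lp_cball M p A r)) f f (Lp_zero M p)"
      using on_outside on_Lp by (intro self_deriv) auto
  next
    assume "g \<in> Lp_cyl M p A r - Lp_on M p A"
    then show "Lp_has_dir_deriv M p (Lp_proj M p (Lp_cball M p A r)) g h (Lp_restr M p A h)"
      by (intro inside_deriv) (simp add: Lp_cyl_def Lp_ball_def)
  next
    assume "g \<in> Lp M p - (Lp_ccyl M p A r \<union> Lp_on M p A)"
    then show "Lp_has_dir_deriv M p (Lp_proj M p (Lp_cball M p A r)) g h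
          (Lp_scale M p (r / Lp_norm M p (Lp_restr M p A g))
            (Lp_diff M p (Lp_restr M p A h)
              (Lp_scale M p
                (Lp_smoothness M p (Lp_restr M p A g) (Lp_restr M p A h)
                   / Lp_norm M p (Lp_restr M p A g))
                (Lp_restr M p A g))))"
      by (intro outside_deriv outside)
  next
    fix f :: "('a \<Rightarrow> 'b) set" assume "f \<in> Lp M p - (Lp_ccyl M p A r \<union> Lp_on M p A)"
    then show "Lp_has_dir_deriv M p (Lp_proj M p (Lp_cball M p A r)) f f (Lp_zero M p)"
      using outside by (intro self_deriv) auto
  qed
qed

end
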